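(* Let $q>0$, $a:[0,\infty)\to[0,\infty)$ continuous and $r:[0,\infty)\to[0,q]$ with $q=\sup_{t\ge0}r(t)$, and assume: (A1) the zero solution of $x'(t)=-a(t)x(t-r(t))$ is uniformly asymptotically stable; (A2) $a_0:=\sup_{t\ge0}|a(t)|<\infty$; (A3) $r$ is uniformly continuous on $[0,\infty)$. Let $K>0,\sigma>0$ be constants such that $|U(t;s,\phi)|\le K\|\phi\|_q e^{-\sigma(t-s)}$ for all $t\ge s\ge0$ and $\phi\in C([-q,0],\mathbb R)$. Set $t_0:=3q+w_r(q)$ and, for $h=q/k$ ($k\ge1$ an integer), $K_1(h):=a_0^2\,[2h+w_r(h)]\,K$; then $K_1(h)\to0$ as $h\to0$. Moreover, there is a constant $M_1>0$, independent of $h$ and $\varphi$, such that for every $h=q/k$ with $K_1(h)<\sigma$ there exists $\eta=\eta(h)>0$ such that for every $\varphi\in C([-q,0],\mathbb R)$ $$|x(\varphi)(t)-z_h(\varphi)(t)|\le\Big[K\,\|E_{h,t_0}\|_q+K_1(h)\,M_1\,\|\varphi\|_q\,t\Big]e^{-\eta(t-t_0)}\qquad\text{for all } t\ge t_0 .$$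
   Context: $C([-q,0],\mathbb R)$ carries the sup norm $\|\phi\|_q=\sup_{-q\le\theta\le0}|\phi(\theta)|$. $U(t;s,\phi)$ denotes the value at time $t$ of the unique solution of $x'(t)=-a(t)x(t-r(t))$ with initial segment $x_s=\phi$ at time $s$ (where $x_s(\theta)=x(s+\theta)$, $-q\le\theta\le0$). $x(\varphi)$ is the solution of $x'(t)=-a(t)x(t-r(t))$, $t\ge0$, with $x(t)=\varphi(t)$ on $[-q,0]$. For $h=q/k$ and $k_i:=\lfloor r(ih)/h\rfloor$, $z_h(\varphi)$ is the solution of $z_h'(t)=-a(t)z_h((i-k_i)h)$ on $[ih,(i+1)h)$, $i\ge0$, continuous on $[0,\infty)$, with $z_h(nh)=\varphi(nh)$ for $n=-k,\dots,0$. $E_h:=x(\varphi)-z_h(\varphi)$ on $[0,\infty)$, and $\|E_{h,t_0}\|_q=\sup_{t_0-q\le s\le t_0}|E_h(s)|$. The global modulus of continuity is $w_r(\ell)=\sup\{|r(t_2)-r(t_1)|:\ t_1,t_2\ge0,\ |t_2-t_1|\le\ell\}$. *)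

theory Defs
  imports "HOL-Analysis.Analysis"
begin

definition supnorm :: "real \<Rightarrow> (real \<Rightarrow> real) \<Rightarrow> real" where
  "supnorm q \<phi> = (SUP \<theta>\<in>{-q..0}. \<bar>\<phi> \<theta>\<bar>)"

definition dde_sol :: "(real \<Rightarrow> real) \<Rightarrow> (real \<Rightarrow> real) \<Rightarrow> real \<Rightarrow> real \<Rightarrow> (real \<Rightarrow> real) \<Rightarrow> bool" where
  "dde_sol a r q s x \<longleftrightarrow>
     continuous_on {s - q..} x \<and>
     (\<forall>t\<ge>s. (x has_real_derivative (- a t * x (t - r t))) (at t within {s..}))"

definition is_U :: "(real \<Rightarrow> real) \<Rightarrow> (real \<Rightarrow> real) \<Rightarrow> real \<Rightarrow> real \<Rightarrow> (real \<Rightarrow> real) \<Rightarrow> (real \<Rightarrow> real) \<Rightarrow> bool" where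
  "is_U a r q s \<phi> x \<longleftrightarrow> dde_sol a r q s x \<and> (\<forall>\<theta>\<in>{-q..0}. x (s + \<theta>) = \<phi> \<theta>)"

definition unif_asym_stable :: "(real \<Rightarrow> real) \<Rightarrow> (real \<Rightarrow> real) \<Rightarrow> real \<Rightarrow> bool" where
  "unif_asym_stable a r q \<longleftrightarrow>
    (\<forall>\<epsilon>>0. \<exists>\<delta>>0. \<forall>s\<ge>0. \<forall>\<phi> x. continuous_on {-q..0} \<phi> \<and> is_U a r q s \<phi> x \<and> supnorm q \<phi> < \<delta>
        \<longrightarrow> (\<forall>t\<ge>s. \<bar>x t\<bar> < \<epsilon>)) \<and>
    (\<exists>\<delta>0>0. \<forall>\<epsilon>>0. \<exists>T>0. \<forall>s\<ge>0. \<forall>\<phi> x. continuous_on {-q..0} \<phi> \<and> is_U a r q s \<phi> x \<and> supnorm q \<phi> < \<delta>0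
        \<longrightarrow> (\<forall>t\<ge>s + T. \<bar>x t\<bar> < \<epsilon>))"

definition modcont :: "(real \<Rightarrow> real) \<Rightarrow> real \<Rightarrow> real" where
  "modcont r l = (SUP p\<in>{(t1, t2). t1 \<ge> 0 \<and> t2 \<ge> 0 \<and> \<bar>t2 - t1\<bar> \<le> l}. \<bar>r (snd p) - r (fst p)\<bar>)"

definition is_zh :: "(real \<Rightarrow> real) \<Rightarrow> (real \<Rightarrow> real) \<Rightarrow> real \<Rightarrow> nat \<Rightarrow> (real \<Rightarrow> real) \<Rightarrow> (real \<Rightarrow> real) \<Rightarrow> bool" where
  "is_zh a r q k \<phi> z \<longleftrightarrow>
     (let h = q / real k in
       continuous_on {0..} z \<and>
       (\<forall>n::int. - int k \<le> n \<and> n \<le> 0 \<longrightarrow> z (of_int n * h) = \<phi> (of_int n * h)) \<and>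
       (\<forall>i::nat. \<forall>t\<in>{real i * h..<(real i + 1) * h}.
          (z has_real_derivative
             (- a t * z (of_int (int i - \<lfloor>r (real i * h) / h\<rfloor>) * h)))
            (at t within {real i * h..<(real i + 1) * h})))"

end

theory Submission
  imports Defs
begin

text \<open>The error \<open>E = x - z\<close> solves the delay equation with the perturbation
  \<open>f t = - a t * (z (t - r t) - z ((i - k\<^sub>i) * h))\<close>. The two arguments of \<open>z\<close> are at most
  \<open>2 * h + w\<^sub>r h\<close> apart and \<open>\<bar>z'\<bar>\<close> is at most \<open>a0\<close> times an earlier value of \<open>\<bar>z\<bar>\<close>, so \<open>K * \<bar>f t\<bar>\<close> is at most
  \<open>K1 h\<close> times the maximum of \<open>\<bar>z\<bar> \<le> \<bar>E\<bar> + \<bar>x\<bar>\<close> over \<open>[t - 4 * q, t]\<close>. Variation of constants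
  turns exponential stability into a Halanay-type integral inequality for \<open>\<bar>E\<bar>\<close>, and the claimed
  bound is a supersolution of it once \<open>\<eta> + K1 h * exp (4 * q * \<eta>) \<le> \<sigma>\<close>; such an \<open>\<eta> > 0\<close> exists
  because \<open>K1 h < \<sigma>\<close>. Values of \<open>z\<close> before \<open>t0\<close> are at most \<open>exp (a0 * t0)\<close> times the norm of \<open>\<phi>\<close>
  and are absorbed into \<open>M1\<close>.\<close>

subsection \<open>Existence of solutions\<close>

text \<open>The approximation \<open>z\<close> may have corners at mesh points, so the mean value
  inequality must tolerate a finite exceptional set. It follows by integrating the derivative, set
  to 0 on \<open>S\<close>.\<close>

lemma abs_diff_le_of_deriv_bound:
  fixes F F' :: "real \<Rightarrow> real"
  assumes cd: "c \<le> d" and fin: "finite (S \<inter> {c..d})" and cont: "continuous_on {c..d} F"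
    and der: "\<And>t. c < t \<Longrightarrow> t < d \<Longrightarrow> t \<notin> S \<Longrightarrow> (F has_real_derivative F' t) (at t)"
    and bound: "\<And>t. c < t \<Longrightarrow> t < d \<Longrightarrow> t \<notin> S \<Longrightarrow> \<bar>F' t\<bar> \<le> M"
    and M: "0 \<le> M"
  shows "\<bar>F d - F c\<bar> \<le> M * (d - c)"
proof -
  define G where "G t = (if c < t \<and> t < d \<and> t \<notin> S then F' t else 0)" for t
  have "(G has_integral (F d - F c)) {c..d}"
  proof (rule fundamental_theorem_of_calculus_interior_strong[OF fin cd _ cont])
    fix t assume t: "t \<in> {c<..<d} - S \<inter> {c..d}"
    then have "G t = F' t" by (auto simp: G_def)
    then show "(F has_vector_derivative G t) (at t)"
      using der[of t] t by (auto simp: has_real_derivative_iff_has_vector_derivative)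
  qed
  moreover have "norm (G t) \<le> M" for t
    using bound[of t] M by (auto simp: G_def)
  ultimately have "norm (F d - F c) \<le> M * measure lborel (cbox c d)"
    using has_integral_bound[of M G "F d - F c" c d] M by auto
  then show ?thesis using cd by simp
qed

lemma at_within_atLeastAtMost_eq_atLeast:
  fixes s t :: real
  assumes "t < b"
  shows "at t within {s..b} = at t within {s..}"
  by (rule at_within_nhd[of t "{..<b}"]) (use assms in auto)

lemma integral_has_real_derivative_atLeast:
  fixes f :: "real \<Rightarrow> real"
  assumes "continuous_on {s..} f" "s \<le> t"
  shows "((\<lambda>x. integral {s..x} f) has_real_derivative f t) (at t within {s..})"
proof -
  have "((\<lambda>x. integral {s..x} f) has_real_derivative f t) (at t within {s..t+1})"
    by (rule integral_has_real_derivative)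
      (use assms in \<open>auto intro: continuous_on_subset\<close>)
  then show ?thesis
    by (simp add: at_within_atLeastAtMost_eq_atLeast)
qed

text \<open>The factor \<open>1 / l\<close> gained by integrating the exponential turns the
  Lipschitz constant \<open>a0\<close> into the contraction constant \<open>a0 / l\<close>.\<close>

lemma abs_integral_le_exp:
  fixes f :: "real \<Rightarrow> real"
  assumes f: "continuous_on {s..} f" and l: "l > 0" and st: "s \<le> t" and C: "C \<ge> 0"
    and bound: "\<And>u. s \<le> u \<Longrightarrow> \<bar>f u\<bar> \<le> C * exp (l * (u - s))"
  shows "\<bar>integral {s..t} f\<bar> \<le> C / l * exp (l * (t - s))"
proof -
  have d: "((\<lambda>u. C / l * exp (l * (u - s))) has_vector_derivative C * exp (l * (u - s))) (at u within {s..t})" for u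
    unfolding has_real_derivative_iff_has_vector_derivative[symmetric]
    using l by (auto intro!: derivative_eq_intros)
  have i: "((\<lambda>u. C * exp (l * (u - s))) has_integral (C / l * exp (l * (t - s)) - C / l * exp (l * (s - s)))) {s..t}"
    by (rule fundamental_theorem_of_calculus[OF st]) (rule d)
  have "f integrable_on {s..t}"
    by (rule integrable_continuous_real) (rule continuous_on_subset[OF f], auto)
  then have "norm (integral {s..t} f) \<le> integral {s..t} (\<lambda>u. C * exp (l * (u - s)))"
    by (rule integral_norm_bound_integral) (use i bound in auto)
  also have "\<dots> = C / l * exp (l * (t - s)) - C / l"
    using integral_unique[OF i] by simp
  also have "\<dots> \<le> C / l * exp (l * (t - s))" using C l by simp
  finally show ?thesis by simp
qed

section \<open>Global solutions for bounded coefficients\<close>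

locale bounded_dde =
  fixes a r :: "real \<Rightarrow> real" and q a0 :: real
  assumes q_pos: "q > 0"
    and a_cont: "continuous_on {0..} a"
    and a_bound: "\<And>t. t \<ge> 0 \<Longrightarrow> \<bar>a t\<bar> \<le> a0"
    and r_cont: "continuous_on {0..} r"
    and r_nonneg: "\<And>t. t \<ge> 0 \<Longrightarrow> 0 \<le> r t"
    and r_le: "\<And>t. t \<ge> 0 \<Longrightarrow> r t \<le> q"
begin

lemma a0_nonneg: "a0 \<ge> 0"
  using a_bound[of 0] by linarith

text \<open>In the norm weighted by \<open>exp (- l * (t - s))\<close> with \<open>l > a0\<close>, the Picard operator is a
  contraction on the whole half-line.\<close>

lemma dde_sol_exists:
  assumes s: "s \<ge> 0" and psi: "continuous_on {s - q..s} \<psi>"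
  shows "\<exists>x. dde_sol a r q s x \<and> (\<forall>t\<in>{s - q..s}. x t = \<psi> t)"
proof -
  \<comment> \<open>The summand 1 covers \<open>a0 = 0\<close>, where \<open>l\<close> must still be
    positive.\<close>
  define l where "l = 2 * a0 + 1"
  have l: "l > 0" "a0 / l < 1" using a0_nonneg by (auto simp: l_def)
  \<comment> \<open>Constant extension beyond both ends: the fixed point is sought among bounded
    continuous functions on the whole line.\<close>
  define \<psi>' where "\<psi>' t = \<psi> (max (s - q) (min s t))" for t
  have psi': "continuous_on UNIV \<psi>'"
    unfolding \<psi>'_def
    by (rule continuous_on_compose2[OF psi]) (use q_pos in \<open>auto intro!: continuous_intros\<close>)
  obtain B where B: "\<And>t. \<bar>\<psi>' t\<bar> \<le> B"
  proof -
    have "compact (\<psi> ` {s - q..s})" by (rule compact_continuous_image[OF psi]) auto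
    then obtain B where "\<forall>y\<in>\<psi> ` {s - q..s}. norm y \<le> B"
      using compact_imp_bounded bounded_iff by metis
    then have "\<bar>\<psi>' t\<bar> \<le> B" for t using q_pos by (auto simp: \<psi>'_def)
    then show ?thesis using that by blast
  qed
  define wt where "wt t = exp (l * max 0 (t - s))" for t
  have wt_cont: "continuous_on X wt" for X unfolding wt_def by (intro continuous_intros)
  have wt_ge1: "wt t \<ge> 1" for t unfolding wt_def using l by simp
  \<comment> \<open>The unknown is \<open>y = x / wt\<close>, so \<open>k y u\<close> is
    \<open>a u * x (u - r u)\<close> expressed through \<open>y\<close>.\<close>
  define k where "k y u = a u * (wt (u - r u) * apply_bcontfun y (u - r u))"
    for y :: "real \<Rightarrow>\<^sub>C real" and u
  have a_c: "continuous_on {s..} a" and r_c: "continuous_on {s..} r"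
    using a_cont r_cont s by (auto intro: continuous_on_subset)
  have ur: "continuous_on {s..} (\<lambda>u. u - r u)" by (intro continuous_intros r_c)
  have k_cont: "continuous_on {s..} (k y)" for y
    unfolding k_def
    by (intro continuous_intros a_c continuous_on_compose2[OF wt_cont[of UNIV] ur]
        continuous_on_compose2[OF continuous_on_apply_bcontfun[of UNIV y] ur]) auto
  have wt_le: "wt (u - r u) \<le> exp (l * (u - s))" if "s \<le> u" for u
    unfolding wt_def using l r_nonneg[of u] that s by (auto simp: max_def)
  \<comment> \<open>The \<open>max\<close> makes the integral vanish before \<open>s\<close>, so the
    Picard operator keeps the initial data.\<close>
  define I where "I y t = integral {s..max s t} (k y)" for y t
  have I_cont: "continuous_on UNIV (I y)" for y
  proof -
    have "continuous_on {s..} (\<lambda>t. integral {s..t} (k y))"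
      using integral_has_real_derivative_atLeast[OF k_cont]
      by (intro DERIV_continuous_on) auto
    then show ?thesis unfolding I_def
      by (rule continuous_on_compose2) (auto intro!: continuous_intros)
  qed
  have k_diff: "\<bar>k y u - k y' u\<bar> \<le> (a0 * dist y y') * exp (l * (u - s))" if u: "s \<le> u" for y y' u
  proof -
    have "\<bar>k y u - k y' u\<bar> = \<bar>a u\<bar> * (wt (u - r u) * \<bar>apply_bcontfun y (u - r u) - apply_bcontfun y' (u - r u)\<bar>)"
      using wt_ge1[of "u - r u"] by (simp add: k_def abs_mult flip: right_diff_distrib)
    also have "\<dots> \<le> a0 * (exp (l * (u - s)) * dist y y')"
      using dist_bounded[of y "u - r u" y'] wt_le[OF u] a_bound[of u] u s wt_ge1[of "u - r u"] a0_nonneg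
      by (intro mult_mono) (auto simp: dist_real_def)
    finally show ?thesis by (simp add: algebra_simps)
  qed
  have I_diff: "\<bar>I y t - I y' t\<bar> \<le> (a0 / l * dist y y') * wt t" for y y' t
  proof -
    have int: "k y integrable_on {s..max s t}" for y
      by (rule integrable_continuous_real) (rule continuous_on_subset[OF k_cont], auto)
    have "I y t - I y' t = integral {s..max s t} (\<lambda>u. k y u - k y' u)"
      unfolding I_def by (rule integral_diff[symmetric]) (rule int)+
    also have "\<bar>\<dots>\<bar> \<le> (a0 * dist y y') / l * exp (l * (max s t - s))"
      by (rule abs_integral_le_exp[OF _ l(1)])
        (use k_diff a0_nonneg in \<open>auto intro!: continuous_intros k_cont\<close>)
    also have "max s t - s = max 0 (t - s)" by auto
    finally show ?thesis by (simp add: wt_def)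
  qed
  \<comment> \<open>Comparison with \<open>I 0 = 0\<close> turns the Lipschitz estimate into a
    growth bound, hence \<open>P y\<close> is bounded.\<close>
  have I0: "I 0 t = 0" for t 
  proof -
    have "k 0 = (\<lambda>u. 0)" by (auto simp: k_def zero_bcontfun.rep_eq)
    then show ?thesis by (simp add: I_def)
  qed
  define P where "P y t = (\<psi>' t - I y t) / wt t" for y t
  have P_b: "P y \<in> bcontfun" for y
  proof (rule bcontfun_normI)
    show "continuous_on UNIV (P y)" unfolding P_def
      by (intro continuous_intros psi' I_cont wt_cont) (simp add: wt_def)
    fix t
    have "B \<ge> 0" using B[of 0] by linarith
    have "\<bar>\<psi>' t - I y t\<bar> \<le> B + (a0 / l * dist y 0) * wt t"
      using B[of t] I_diff[of y t 0] I0[of t] by linarith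
    also have "\<dots> \<le> B * wt t + (a0 / l * dist y 0) * wt t"
      using mult_left_mono[OF wt_ge1[of t] \<open>B \<ge> 0\<close>] by simp
    finally show "norm (P y t) \<le> B + a0 / l * dist y 0"
      using wt_ge1[of t] by (simp add: P_def pos_divide_le_eq distrib_right)
  qed
  have P_ap: "apply_bcontfun (Bcontfun (P y)) = P y" for y by (rule Bcontfun_inverse[OF P_b])
  have "\<exists>!y. Bcontfun (P y) = y"
  proof (rule banach_fix_type)
    show "0 \<le> a0 / l" "a0 / l < 1" using l a0_nonneg by auto
    show "\<forall>y y'. dist (Bcontfun (P y)) (Bcontfun (P y')) \<le> a0 / l * dist y y'"
    proof (intro allI dist_bound)
      fix y y' t
      have "P y t - P y' t = (I y' t - I y t) / wt t"
        by (simp add: P_def diff_divide_distrib)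
      then have "\<bar>P y t - P y' t\<bar> = \<bar>I y t - I y' t\<bar> / wt t"
        using wt_ge1[of t] by (simp add: abs_minus_commute)
      also have "\<dots> \<le> a0 / l * dist y y'"
        using I_diff[of y t y'] wt_ge1[of t] by (simp add: pos_divide_le_eq)
      finally show "dist (apply_bcontfun (Bcontfun (P y)) t) (apply_bcontfun (Bcontfun (P y')) t) \<le> a0 / l * dist y y'"
        by (simp add: P_ap dist_real_def)
    qed
  qed
  then obtain y where "Bcontfun (P y) = y" by blast
  then have y: "apply_bcontfun y = P y" using P_ap[of y] by simp
  define x where "x t = wt t * apply_bcontfun y t" for t
  have x_eq: "x t = \<psi>' t - I y t" for t
    using wt_ge1[of t] unfolding x_def y by (simp add: P_def)
  have x_cont: "continuous_on X x" for X
    unfolding x_def by (intro continuous_intros wt_cont) auto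
  have "(x has_real_derivative (- a t * x (t - r t))) (at t within {s..})" if t: "t \<ge> s" for t
  proof -
    have "((\<lambda>t. \<psi>' s - integral {s..t} (k y)) has_real_derivative (0 - k y t)) (at t within {s..})"
      by (intro DERIV_diff DERIV_const integral_has_real_derivative_atLeast k_cont t)
    moreover have "\<psi>' s - integral {s..u} (k y) = x u" if "u \<in> {s..}" for u
      using that q_pos by (simp add: x_eq I_def \<psi>'_def max_def min_def)
    moreover have "0 - k y t = - a t * x (t - r t)" by (simp add: k_def x_def)
    ultimately show ?thesis
      using t by (auto elim!: has_field_derivative_transform_within[OF _ zero_less_one])
  qed
  then have "dde_sol a r q s x" unfolding dde_sol_def using x_cont by blast
  moreover have "\<forall>t\<in>{s - q..s}. x t = \<psi> t"
    by (auto simp: x_eq I_def \<psi>'_def max_def min_def)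
  ultimately show ?thesis by blast
qed

end

subsection \<open>Perturbed equations\<close>

lemma abs_le_supnorm:
  assumes "continuous_on {-q..0} \<phi>" "\<theta> \<in> {-q..0}"
  shows "\<bar>\<phi> \<theta>\<bar> \<le> supnorm q \<phi>"
proof -
  have "compact ((\<lambda>\<theta>. \<bar>\<phi> \<theta>\<bar>) ` {-q..0})"
    by (rule compact_continuous_image) (use assms in \<open>auto intro!: continuous_intros\<close>)
  then have "bdd_above ((\<lambda>\<theta>. \<bar>\<phi> \<theta>\<bar>) ` {-q..0})"
    by (intro bounded_imp_bdd_above compact_imp_bounded)
  then show ?thesis unfolding supnorm_def using assms(2) by (rule cSUP_upper2) auto
qed

lemma supnorm_le:
  assumes "q \<ge> 0" "\<And>\<theta>. \<theta> \<in> {-q..0} \<Longrightarrow> \<bar>\<phi> \<theta>\<bar> \<le> B"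
  shows "supnorm q \<phi> \<le> B"
  unfolding supnorm_def by (rule cSUP_least) (use assms in auto)

text \<open>Splitting the increment at \<open>x\<close> makes the derivative estimate uniform over
  all short intervals containing \<open>x\<close>, as a bisection argument requires.\<close>

lemma straddle_lower:
  fixes \<Phi> :: "real \<Rightarrow> real"
  assumes der: "(\<Phi> has_real_derivative D) (at x within S)" and x: "x \<in> S" and e: "e > 0"
  shows "\<exists>d>0. \<forall>u v. u \<in> S \<and> v \<in> S \<and> u \<le> x \<and> x \<le> v \<and> v - u < d \<longrightarrow>
    (D - e) * (v - u) \<le> \<Phi> v - \<Phi> u"
proof -
  have "(\<Phi> has_derivative (\<lambda>h. D * h)) (at x within S)"
    using der by (simp add: has_field_derivative_def)
  then obtain d where d: "d > 0"
    "\<And>y. y \<in> S \<Longrightarrow> norm (y - x) < d \<Longrightarrow> norm (\<Phi> y - \<Phi> x - D * (y - x)) \<le> e * norm (y - x)"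
    using e unfolding has_derivative_within_alt by meson
  show ?thesis
  proof (intro exI conjI allI impI)
    show "d > 0" by (rule d)
    fix u v assume uv: "u \<in> S \<and> v \<in> S \<and> u \<le> x \<and> x \<le> v \<and> v - u < d"
    have "\<bar>\<Phi> u - \<Phi> x - D * (u - x)\<bar> \<le> e * (x - u)" using d(2)[of u] uv by auto
    moreover have "\<bar>\<Phi> v - \<Phi> x - D * (v - x)\<bar> \<le> e * (v - x)" using d(2)[of v] uv by auto
    ultimately show "(D - e) * (v - u) \<le> \<Phi> v - \<Phi> u" by (simp add: algebra_simps abs_le_iff)
  qed
qed

text \<open>Linearity, for comparing solutions started at different times: the older one still
  solves the equation from the newer start.\<close>

lemma dde_sol_diff:
  assumes x: "dde_sol a r q s x" and y: "dde_sol a r q s' y" and "s \<le> s'"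
  shows "dde_sol a r q s' (\<lambda>t. y t - x t)"
proof -
  have "((\<lambda>t. y t - x t) has_real_derivative (- a t * (y (t - r t) - x (t - r t)))) (at t within {s'..})"
    if "t \<ge> s'" for t
  proof -
    have "(x has_real_derivative (- a t * x (t - r t))) (at t within {s'..})"
      by (rule has_field_derivative_subset[of _ _ _ "{s..}"]) (use x that assms in \<open>auto simp: dde_sol_def\<close>)
    moreover have "(y has_real_derivative (- a t * y (t - r t))) (at t within {s'..})"
      using y that by (auto simp: dde_sol_def)
    ultimately show ?thesis
      by (auto intro!: derivative_eq_intros simp: algebra_simps)
  qed
  moreover have "continuous_on {s' - q..} (\<lambda>t. y t - x t)"
    using x y \<open>s \<le> s'\<close> unfolding dde_sol_def
    by (auto intro!: continuous_intros intro: continuous_on_subset)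
  ultimately show ?thesis unfolding dde_sol_def by blast
qed

lemma dde_sol_has_derivative_at:
  assumes "dde_sol a r q s x" "s < t"
  shows "(x has_real_derivative (- a t * x (t - r t))) (at t)"
proof -
  have "(x has_real_derivative (- a t * x (t - r t))) (at t within {s<..})"
    by (rule has_field_derivative_subset[of _ _ _ "{s..}"]) (use assms in \<open>auto simp: dde_sol_def\<close>)
  then show ?thesis using assms(2) by (simp add: at_within_open[of _ "{s<..}"])
qed

section \<open>Perturbations of an exponentially stable equation\<close>

locale exp_stable_dde = bounded_dde +
  fixes K \<sigma> :: real
  assumes K_pos: "K > 0" and sigma_pos: "\<sigma> > 0"
    and exp_stable: "\<And>s \<phi> x t. s \<ge> 0 \<Longrightarrow> continuous_on {-q..0} \<phi> \<Longrightarrow> is_U a r q s \<phi> x \<Longrightarrow> t \<ge> s \<Longrightarrow>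
      \<bar>x t\<bar> \<le> K * supnorm q \<phi> * exp (- \<sigma> * (t - s))"
begin

text \<open>Stability applied to the solution's own segment at \<open>s\<close>, with any pointwise
  bound in place of its norm.\<close>

lemma sol_bound:
  assumes s: "s \<ge> 0" and x: "dde_sol a r q s x" and t: "t \<ge> s"
    and B: "\<And>u. u \<in> {s - q..s} \<Longrightarrow> \<bar>x u\<bar> \<le> B"
  shows "\<bar>x t\<bar> \<le> K * B * exp (- \<sigma> * (t - s))"
proof -
  have "continuous_on {-q..0} (\<lambda>\<theta>. x (s + \<theta>))"
    using x unfolding dde_sol_def
    by (auto intro!: continuous_on_compose2[of "{s - q..}" x] continuous_intros)
  then have "\<bar>x t\<bar> \<le> K * supnorm q (\<lambda>\<theta>. x (s + \<theta>)) * exp (- \<sigma> * (t - s))"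
    by (rule exp_stable[OF s _ _ t]) (use x in \<open>auto simp: is_U_def\<close>)
  also have "\<dots> \<le> K * B * exp (- \<sigma> * (t - s))"
    using K_pos q_pos by (intro mult_right_mono mult_left_mono supnorm_le B) auto
  finally show ?thesis .
qed

text \<open>A maximum \<open>\<bar>D p\<bar>\<close> over the whole interval also dominates the
  delayed values, so integrating from \<open>s1\<close> bounds it by
  \<open>(a0 * \<bar>D p\<bar> + G) * (s2 - s1)\<close>. On a short interval this can be solved for
  \<open>\<bar>D p\<bar>\<close>, with a result of first order in \<open>s2 - s1\<close>.\<close>

lemma perturbation_small_step:
  assumes s1: "s1 \<ge> 0" "s1 \<le> s2" and fin: "\<And>c d. finite (S \<inter> {c..d::real})"
    and cont: "continuous_on {s1 - q..s2} D"
    and zero: "\<And>t. t \<in> {s1 - q..s1} \<Longrightarrow> D t = 0"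
    and der: "\<And>t. s1 < t \<Longrightarrow> t < s2 \<Longrightarrow> t \<notin> S \<Longrightarrow>
      (D has_real_derivative (- a t * D (t - r t) + f t)) (at t)"
    and f: "\<And>t. s1 < t \<Longrightarrow> t < s2 \<Longrightarrow> t \<notin> S \<Longrightarrow> \<bar>f t\<bar> \<le> G" and G: "G \<ge> 0"
    and small: "a0 * (s2 - s1) < 1" and t: "t \<in> {s1 - q..s2}"
  shows "\<bar>D t\<bar> \<le> (s2 - s1) * (G / (1 - a0 * (s2 - s1)))"
proof -
  have "continuous_on {s1 - q..s2} (\<lambda>t. \<bar>D t\<bar>)" using cont by (intro continuous_intros)
  then obtain p where p: "p \<in> {s1 - q..s2}" "\<And>t. t \<in> {s1 - q..s2} \<Longrightarrow> \<bar>D t\<bar> \<le> \<bar>D p\<bar>"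
    using continuous_attains_sup[of "{s1 - q..s2}" "\<lambda>t. \<bar>D t\<bar>"] s1 q_pos by auto
  have "\<bar>D p\<bar> \<le> (a0 * \<bar>D p\<bar> + G) * (s2 - s1)"
  proof (cases "p \<le> s1")
    case True
    then show ?thesis using zero[of p] p G s1 by auto
  next
    case False
    have "\<bar>D p - D s1\<bar> \<le> (a0 * \<bar>D p\<bar> + G) * (p - s1)"
    proof (rule abs_diff_le_of_deriv_bound[OF _ fin])
      show "continuous_on {s1..p} D"
        by (rule continuous_on_subset[OF cont]) (use p q_pos in auto)
      fix t assume t: "s1 < t" "t < p" "t \<notin> S"
      show "(D has_real_derivative (- a t * D (t - r t) + f t)) (at t)"
        using der t p by auto
      have "t - r t \<in> {s1 - q..s2}" using r_nonneg[of t] r_le[of t] t p s1 by auto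
      then have "\<bar>a t\<bar> * \<bar>D (t - r t)\<bar> \<le> a0 * \<bar>D p\<bar>"
        using a_bound[of t] t s1 p(2) by (intro mult_mono) auto
      moreover have "\<bar>f t\<bar> \<le> G" using f t p by auto
      ultimately show "\<bar>- a t * D (t - r t) + f t\<bar> \<le> a0 * \<bar>D p\<bar> + G"
        by (intro order_trans[OF abs_triangle_ineq]) (auto simp: abs_mult)
    qed (use False a0_nonneg G in auto)
    also have "\<dots> \<le> (a0 * \<bar>D p\<bar> + G) * (s2 - s1)"
      using p a0_nonneg G by (intro mult_left_mono) auto
    finally show ?thesis using zero[of s1] q_pos by auto
  qed
  then have "\<bar>D p\<bar> * (1 - a0 * (s2 - s1)) \<le> (s2 - s1) * G" by (simp add: algebra_simps)
  then have "\<bar>D p\<bar> \<le> (s2 - s1) * (G / (1 - a0 * (s2 - s1)))"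
    using small by (simp add: pos_le_divide_eq)
  then show ?thesis using p(2)[OF t] by linarith
qed

text \<open>A form of the variation of constants formula that needs no fundamental solution: for fixed
  \<open>T\<close>, let \<open>W s\<close> be the value at \<open>T\<close> of the unperturbed solution that agrees with \<open>E\<close> on
  \<open>[s - q, s]\<close>. Then \<open>W t0\<close> is controlled by stability, \<open>W T = E T\<close>, and the increments of \<open>W\<close> are
  controlled by the perturbation \<open>f\<close>.\<close>

lemma perturbation_bound:
  assumes t0: "t0 \<ge> 0" and T: "T \<ge> t0" and fin: "\<And>c d. finite (S \<inter> {c..d::real})"
    and E_cont: "continuous_on {t0 - q..} E"
    and E_der: "\<And>t. t0 < t \<Longrightarrow> t \<notin> S \<Longrightarrow>
      (E has_real_derivative (- a t * E (t - r t) + f t)) (at t)"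
    and f: "\<And>t. t0 < t \<Longrightarrow> t < T \<Longrightarrow> t \<notin> S \<Longrightarrow> \<bar>f t\<bar> \<le> g t"
    and g_cont: "continuous_on {t0..T} g" and g_nonneg: "\<And>t. t \<in> {t0..T} \<Longrightarrow> g t \<ge> 0"
    and v_der: "\<And>t. t \<in> {t0..T} \<Longrightarrow> (v has_real_derivative v' t) (at t within {t0..T})"
    and v_super: "\<And>t. t \<in> {t0..T} \<Longrightarrow> - \<sigma> * v t + K * g t \<le> v' t"
    and v_init: "\<And>u. u \<in> {t0 - q..t0} \<Longrightarrow> K * \<bar>E u\<bar> \<le> v t0"
  shows "\<bar>E T\<bar> \<le> v T"
proof -
  have "\<exists>x. dde_sol a r q s x \<and> (\<forall>t\<in>{s - q..s}. x t = E t)" if "s \<ge> t0" for s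
    by (rule dde_sol_exists) (use that t0 in \<open>auto intro: continuous_on_subset[OF E_cont]\<close>)
  then obtain V where V: "\<And>s. s \<ge> t0 \<Longrightarrow> dde_sol a r q s (V s)"
    and V_init: "\<And>s t. s \<ge> t0 \<Longrightarrow> t \<in> {s - q..s} \<Longrightarrow> V s t = E t"
    by metis
  \<comment> \<open>On \<open>[s2 - q, s2]\<close> the solution \<open>V s2\<close> equals
    \<open>E\<close>, so there the two solutions differ by the small drift of \<open>E\<close> from
    \<open>V s1\<close>; stability then carries this difference from \<open>s2\<close> to
    \<open>T\<close>.\<close>
  have incr: "\<bar>V s2 T - V s1 T\<bar> \<le> (s2 - s1) * (K * exp (- \<sigma> * (T - s2)) * (G / (1 - a0 * (s2 - s1))))"
    if s: "t0 \<le> s1" "s1 \<le> s2" "s2 \<le> T" and G: "G \<ge> 0" "\<And>t. t \<in> {s1..s2} \<Longrightarrow> g t \<le> G"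
      and small: "a0 * (s2 - s1) < 1" for s1 s2 G
  proof -
    have Vc: "continuous_on {s1 - q..} (V s1)" using V[of s1] s by (auto simp: dde_sol_def)
    have D: "\<bar>E t - V s1 t\<bar> \<le> (s2 - s1) * (G / (1 - a0 * (s2 - s1)))" if "t \<in> {s1 - q..s2}" for t
    proof (rule perturbation_small_step[OF _ s(2) fin _ _ _ _ G(1) small that])
      show "continuous_on {s1 - q..s2} (\<lambda>t. E t - V s1 t)"
        by (intro continuous_intros continuous_on_subset[OF E_cont] continuous_on_subset[OF Vc])
          (use s in auto)
      fix t assume t: "s1 < t" "t < s2" "t \<notin> S"
      have "(V s1 has_real_derivative (- a t * V s1 (t - r t))) (at t)"
        by (rule dde_sol_has_derivative_at[OF V]) (use s t in auto)
      then show "((\<lambda>t. E t - V s1 t) has_real_derivative (- a t * (E (t - r t) - V s1 (t - r t)) + f t)) (at t)"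
        using E_der[of t] s t by (auto intro!: derivative_eq_intros simp: algebra_simps)
      show "\<bar>f t\<bar> \<le> G" using f[of t] G(2)[of t] s t by auto
    qed (use s t0 V_init in auto)
    have "\<bar>V s2 T - V s1 T\<bar> \<le> K * ((s2 - s1) * (G / (1 - a0 * (s2 - s1)))) * exp (- \<sigma> * (T - s2))"
    proof (rule sol_bound)
      show "dde_sol a r q s2 (\<lambda>t. V s2 t - V s1 t)"
        by (rule dde_sol_diff[OF V V s(2)]) (use s in auto)
      fix u assume u: "u \<in> {s2 - q..s2}"
      then show "\<bar>V s2 u - V s1 u\<bar> \<le> (s2 - s1) * (G / (1 - a0 * (s2 - s1)))"
        using D[of u] V_init[of s2 u] s by auto
    qed (use s t0 in auto)
    then show ?thesis by (simp add: algebra_simps)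
  qed
  \<comment> \<open>The weight matches the decay in \<open>incr\<close>: by the supersolution
    inequality, the derivative of \<open>\<Phi>\<close> dominates the rate
    \<open>K * exp (- \<sigma> * (T - s)) * g s\<close> at which \<open>V s T\<close> can
    change.\<close>
  define \<Phi> where "\<Phi> s = exp (- \<sigma> * (T - s)) * v s" for s
  have Phi_der: "(\<Phi> has_real_derivative exp (- \<sigma> * (T - s)) * (v' s + \<sigma> * v s)) (at s within {t0..T})"
    if "s \<in> {t0..T}" for s
    unfolding \<Phi>_def using v_der[OF that]
    by (auto intro!: derivative_eq_intros simp: algebra_simps)
  have main: "\<bar>V T T - V t0 T\<bar> \<le> \<Phi> T - \<Phi> t0 + e * (T - t0)" if e: "e > 0" for e
  proof -
    define P where "P s1 s2 \<longleftrightarrow> (t0 \<le> s1 \<and> s2 \<le> T \<longrightarrow>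
      \<bar>V s2 T - V s1 T\<bar> \<le> \<Phi> s2 - \<Phi> s1 + e * (s2 - s1))" for s1 s2
    \<comment> \<open>Interval bisection: \<open>P\<close> is additive over adjacent intervals and
      holds on all short intervals around each point, hence on \<open>[t0, T]\<close>. The slack
      \<open>e\<close> absorbs the local errors.\<close>
    have "P t0 T"
      using T
    proof (induction rule: Bolzano)
      case (trans s1 s2 s3)
      show ?case unfolding P_def
      proof
        assume *: "t0 \<le> s1 \<and> s3 \<le> T"
        have "\<bar>V s2 T - V s1 T\<bar> \<le> \<Phi> s2 - \<Phi> s1 + e * (s2 - s1)"
          "\<bar>V s3 T - V s2 T\<bar> \<le> \<Phi> s3 - \<Phi> s2 + e * (s3 - s2)"
          using trans * unfolding P_def by auto
        then show "\<bar>V s3 T - V s1 T\<bar> \<le> \<Phi> s3 - \<Phi> s1 + e * (s3 - s1)"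
          by (simp add: algebra_simps)
      qed
    next
      case (local x)
      then have x: "x \<in> {t0..T}" by auto
      define c where "c = K * exp (- \<sigma> * (T - x)) * g x"
      define D where "D = exp (- \<sigma> * (T - x)) * (v' x + \<sigma> * v x)"
      have "exp (- \<sigma> * (T - x)) * (K * g x) \<le> D"
        unfolding D_def using v_super[OF x] by (intro mult_left_mono) auto
      then have cD: "c \<le> D" by (simp add: c_def algebra_simps)
      \<comment> \<open>The rate in \<open>incr\<close> when both the interval length and the
        oscillation of \<open>g\<close> are at most \<open>d\<close>; it tends to \<open>c\<close>
        as \<open>d\<close> tends to 0.\<close>
      define \<rho> where "\<rho> d = K * exp (- \<sigma> * (T - (x + d))) * ((g x + d) / (1 - a0 * d))" for d
      have "(\<rho> \<longlongrightarrow> K * exp (- \<sigma> * (T - (x + 0))) * ((g x + 0) / (1 - a0 * 0))) (at_right 0)"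
        unfolding \<rho>_def by (intro tendsto_intros) auto
      then have "(\<rho> \<longlongrightarrow> c) (at_right 0)" by (simp add: c_def)
      then have "\<forall>\<^sub>F d in at_right 0. \<rho> d < c + e / 2"
        by (rule order_tendstoD) (use e in auto)
      moreover have "((\<lambda>d. a0 * d) \<longlongrightarrow> a0 * 0) (at_right 0)" by (intro tendsto_intros)
      then have "\<forall>\<^sub>F d in at_right 0. a0 * d < 1"
        by (rule order_tendstoD) auto
      ultimately have "\<forall>\<^sub>F d in at_right 0. \<rho> d < c + e / 2 \<and> a0 * d < 1 \<and> d > 0"
        using eventually_at_right_less[of "0::real"] by eventually_elim auto
      then obtain d0 where d0: "\<rho> d0 < c + e / 2" "a0 * d0 < 1" "d0 > 0"
        using eventually_happens'[OF trivial_limit_at_right_real] by blast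
      obtain d1 where d1: "d1 > 0" "\<And>y. y \<in> {t0..T} \<Longrightarrow> dist y x < d1 \<Longrightarrow> dist (g y) (g x) < d0"
        using g_cont x d0(3) unfolding continuous_on_iff by metis
      obtain d2 where d2: "d2 > 0" "\<And>u w. u \<in> {t0..T} \<and> w \<in> {t0..T} \<and> u \<le> x \<and> x \<le> w \<and> w - u < d2 \<Longrightarrow>
          (D - e / 2) * (w - u) \<le> \<Phi> w - \<Phi> u"
        using straddle_lower[OF Phi_der[OF x, folded D_def] x, of "e / 2"] e by auto
      show ?case
      proof (intro exI conjI allI impI)
        show "min d0 (min d1 d2) > 0" using d0 d1 d2 by auto
        fix s1 s2 assume s: "s1 \<le> x \<and> x \<le> s2 \<and> s2 - s1 < min d0 (min d1 d2)"
        show "P s1 s2" unfolding P_def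
        proof
          assume s': "t0 \<le> s1 \<and> s2 \<le> T"
          have sd: "s2 - s1 \<le> d0" using s by auto
          have a0d: "a0 * (s2 - s1) \<le> a0 * d0" using sd a0_nonneg by (rule mult_left_mono)
          have gx: "g x \<ge> 0" using g_nonneg x by auto
          have "\<bar>V s2 T - V s1 T\<bar> \<le> (s2 - s1) * (K * exp (- \<sigma> * (T - s2)) * ((g x + d0) / (1 - a0 * (s2 - s1))))"
          proof (rule incr)
            fix t assume t: "t \<in> {s1..s2}"
            then have "dist (g t) (g x) < d0"
              by (intro d1) (use s s' in \<open>auto simp: dist_real_def\<close>)
            then show "g t \<le> g x + d0" by (auto simp: dist_real_def)
          qed (use s s' gx d0 a0d in auto)
          also have "\<dots> \<le> (s2 - s1) * \<rho> d0"
            unfolding \<rho>_def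
          proof (intro mult_left_mono mult_mono frac_le)
            show "exp (- \<sigma> * (T - s2)) \<le> exp (- \<sigma> * (T - (x + d0)))"
              using sigma_pos s by (auto intro!: mult_left_mono)
          qed (use s s' gx d0 a0d K_pos in auto)
          also have "\<dots> \<le> (s2 - s1) * (c + e / 2)"
            using d0 s by (intro mult_left_mono) auto
          \<comment> \<open>Half of the slack pays for replacing \<open>c\<close> by
            \<open>\<rho> d0\<close>, the other half for the difference quotient of
            \<open>\<Phi>\<close>.\<close>
          also have "\<dots> \<le> (s2 - s1) * (D - e / 2 + e)"
            using cD s by (intro mult_left_mono) auto
          also have "\<dots> = (D - e / 2) * (s2 - s1) + e * (s2 - s1)" by (simp add: algebra_simps)
          also have "\<dots> \<le> \<Phi> s2 - \<Phi> s1 + e * (s2 - s1)"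
            using d2(2)[of s1 s2] s s' by auto
          finally show "\<bar>V s2 T - V s1 T\<bar> \<le> \<Phi> s2 - \<Phi> s1 + e * (s2 - s1)" .
        qed
      qed
    qed
    then show ?thesis by (simp add: P_def)
  qed
  have "\<bar>V T T - V t0 T\<bar> \<le> \<Phi> T - \<Phi> t0"
  proof (rule field_le_epsilon)
    fix e :: real assume e: "e > 0"
    \<comment> \<open>The added 1 keeps the denominator positive when \<open>T = t0\<close>.\<close>
    have "e / (T - t0 + 1) * (T - t0) \<le> e"
      using T e by (simp add: pos_divide_le_eq algebra_simps)
    moreover have "e / (T - t0 + 1) > 0" using T e by simp
    ultimately show "\<bar>V T T - V t0 T\<bar> \<le> \<Phi> T - \<Phi> t0 + e"
      using main[of "e / (T - t0 + 1)"] by linarith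
  qed
  \<comment> \<open>The factor \<open>K\<close> is already contained in \<open>v t0\<close>, hence
    the division by \<open>K\<close>.\<close>
  moreover have "\<bar>V t0 T\<bar> \<le> K * (v t0 / K) * exp (- \<sigma> * (T - t0))"
  proof (rule sol_bound[OF t0 V T])
    fix u assume "u \<in> {t0 - q..t0}"
    then show "\<bar>V t0 u\<bar> \<le> v t0 / K"
      using V_init[of t0 u] v_init[of u] K_pos by (simp add: pos_le_divide_eq mult.commute)
  qed simp
  then have "\<bar>V t0 T\<bar> \<le> \<Phi> t0" using K_pos by (simp add: \<Phi>_def mult.commute)
  moreover have "\<Phi> T = v T" by (simp add: \<Phi>_def)
  moreover have "V T T = E T" using V_init[of T T] T q_pos by auto
  ultimately show ?thesis by linarith
qed

end

subsection \<open>The piecewise constant argument approximation\<close>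

text \<open>The argument \<open>(i - k\<^sub>i) * h\<close> for \<open>t \<in> [i * h, (i + 1) * h)\<close>.\<close>

definition mesh_arg :: "(real \<Rightarrow> real) \<Rightarrow> real \<Rightarrow> real \<Rightarrow> real" where
  "mesh_arg r h t = of_int (\<lfloor>t / h\<rfloor> - \<lfloor>r (of_int \<lfloor>t / h\<rfloor> * h) / h\<rfloor>) * h"

lemma finite_mesh_Int_Icc:
  fixes h :: real
  assumes "h > 0"
  shows "finite (range (\<lambda>i::int. of_int i * h) \<inter> {c..d})"
proof (rule finite_subset)
  show "range (\<lambda>i::int. of_int i * h) \<inter> {c..d} \<subseteq> (\<lambda>i. of_int i * h) ` {\<lfloor>c / h\<rfloor>..\<lceil>d / h\<rceil>}"
  proof clarify
    fix i :: int assume "of_int i * h \<in> {c..d}"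
    then have "c / h \<le> of_int i" "of_int i \<le> d / h" using assms by (auto simp: field_simps)
    then have "i \<in> {\<lfloor>c / h\<rfloor>..\<lceil>d / h\<rceil>}" by (auto simp: floor_le_iff le_ceiling_iff)
    then show "of_int i * h \<in> (\<lambda>i. of_int i * h) ` {\<lfloor>c / h\<rfloor>..\<lceil>d / h\<rceil>}" by blast
  qed
qed auto

lemma floor_divide_mult_bounds:
  fixes h x :: real
  assumes "h > 0"
  shows "of_int \<lfloor>x / h\<rfloor> * h \<le> x" "x < of_int \<lfloor>x / h\<rfloor> * h + h"
proof -
  show "of_int \<lfloor>x / h\<rfloor> * h \<le> x"
    using of_int_floor_le[of "x / h"] assms by (simp only: pos_le_divide_eq)
  have "x / h < of_int \<lfloor>x / h\<rfloor> + 1" by linarith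
  then show "x < of_int \<lfloor>x / h\<rfloor> * h + h"
    using assms by (simp only: pos_divide_less_eq distrib_right mult_1)
qed

context bounded_dde
begin

section \<open>Modulus of continuity and mesh arguments\<close>

lemma bdd_above_modcont:
  "bdd_above ((\<lambda>p. \<bar>r (snd p) - r (fst p)\<bar>) ` {(t1, t2). t1 \<ge> 0 \<and> t2 \<ge> 0 \<and> \<bar>t2 - t1\<bar> \<le> l})"
proof (rule bdd_aboveI2)
  fix p assume "p \<in> {(t1, t2). t1 \<ge> 0 \<and> t2 \<ge> 0 \<and> \<bar>t2 - t1\<bar> \<le> l}"
  then have "fst p \<ge> 0" "snd p \<ge> 0" by auto
  then show "\<bar>r (snd p) - r (fst p)\<bar> \<le> q"
    using r_nonneg[of "fst p"] r_le[of "fst p"] r_nonneg[of "snd p"] r_le[of "snd p"] by linarith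
qed

lemma abs_diff_le_modcont:
  assumes "t1 \<ge> 0" "t2 \<ge> 0" "\<bar>t2 - t1\<bar> \<le> l"
  shows "\<bar>r t2 - r t1\<bar> \<le> modcont r l"
  unfolding modcont_def
  by (rule cSUP_upper2[where x = "(t1, t2)"]) (use assms bdd_above_modcont in auto)

lemma modcont_nonneg: "l \<ge> 0 \<Longrightarrow> modcont r l \<ge> 0"
  using abs_diff_le_modcont[of 0 0 l] by simp

lemma tendsto_modcont:
  assumes "uniformly_continuous_on {0..} r"
  shows "(\<lambda>k. modcont r (q / real k)) \<longlonglongrightarrow> 0"
proof (rule LIMSEQ_I)
  \<comment> \<open>Passing to a supremum loses strictness, so uniform continuity is used with
    \<open>e / 2\<close>.\<close>
  fix e :: real assume e: "e > 0"
  then obtain d where d: "d > 0"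
    "\<And>t1 t2. t1 \<in> {0..} \<Longrightarrow> t2 \<in> {0..} \<Longrightarrow> dist t2 t1 < d \<Longrightarrow> dist (r t2) (r t1) < e / 2"
    using assms unfolding uniformly_continuous_on_def by (metis half_gt_zero)
  have "(\<lambda>k. q / real k) \<longlonglongrightarrow> 0" by (rule lim_const_over_n)
  then obtain N where N: "\<And>k. k \<ge> N \<Longrightarrow> norm (q / real k - 0) < d"
    using LIMSEQ_D d(1) by blast
  have "norm (modcont r (q / real k) - 0) < e" if "k \<ge> N" for k
  proof -
    have qk: "q / real k < d" "q / real k \<ge> 0" using N[OF that] q_pos by auto
    have "modcont r (q / real k) \<le> e / 2"
      unfolding modcont_def
    proof (rule cSUP_least)
      have "(0, 0) \<in> {(t1, t2). t1 \<ge> 0 \<and> t2 \<ge> 0 \<and> \<bar>t2 - t1\<bar> \<le> q / real k}" using qk by auto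
      then show "{(t1, t2). t1 \<ge> 0 \<and> t2 \<ge> 0 \<and> \<bar>t2 - t1\<bar> \<le> q / real k} \<noteq> {}" by blast
      fix p assume "p \<in> {(t1, t2). t1 \<ge> 0 \<and> t2 \<ge> 0 \<and> \<bar>t2 - t1\<bar> \<le> q / real k}"
      then have "dist (r (snd p)) (r (fst p)) < e / 2"
        by (intro d(2)) (use qk in \<open>auto simp: dist_real_def\<close>)
      then show "\<bar>r (snd p) - r (fst p)\<bar> \<le> e / 2" by (simp add: dist_real_def)
    qed
    then show ?thesis using modcont_nonneg[OF qk(2)] e by simp
  qed
  then show "\<exists>N. \<forall>k\<ge>N. norm (modcont r (q / real k) - 0) < e" by blast
qed

text \<open>With \<open>i\<close> the cell of \<open>t\<close> and \<open>m\<close> the rounded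
  delay, \<open>t - r t - (i - m) * h\<close> is \<open>t - i * h\<close>, minus
  \<open>r t - r (i * h)\<close>, minus \<open>r (i * h) - m * h\<close>. The outer two lie in
  \<open>[0, h)\<close> and the middle one is controlled by the modulus of continuity. Since
  \<open>r \<le> q = k * h\<close>, no argument precedes \<open>- k * h\<close>.\<close>

lemma mesh_arg_props:
  assumes k: "k \<ge> 1" and h: "h = q / real k" and t: "t \<ge> 0"
  shows "\<exists>n::int. mesh_arg r h t = of_int n * h \<and> - int k \<le> n"
    and "mesh_arg r h t \<le> of_int \<lfloor>t / h\<rfloor> * h"
    and "mesh_arg r h t \<le> t"
    and "t - 2 * q \<le> mesh_arg r h t"
    and "\<bar>t - r t - mesh_arg r h t\<bar> \<le> 2 * h + modcont r h"
proof -
  have hp: "h > 0" using h k q_pos by simp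
  have kh: "real k * h = q" using h k by simp
  have hq: "h \<le> q" using h k q_pos by (simp add: divide_le_eq)
  define i where "i = \<lfloor>t / h\<rfloor>"
  define m where "m = \<lfloor>r (of_int i * h) / h\<rfloor>"
  have i0: "i \<ge> 0" using t hp by (simp add: i_def)
  have ih0: "of_int i * h \<ge> 0" using i0 hp by simp
  have i1: "of_int i * h \<le> t" "t < of_int i * h + h"
    unfolding i_def by (rule floor_divide_mult_bounds[OF hp])+
  have m1: "of_int m * h \<le> r (of_int i * h)" "r (of_int i * h) < of_int m * h + h"
    unfolding m_def by (rule floor_divide_mult_bounds[OF hp])+
  have m0: "m \<ge> 0" using r_nonneg[OF ih0] hp by (simp add: m_def)
  have "of_int m * h \<le> real k * h" using m1 r_le[OF ih0] kh by linarith
  then have mk: "m \<le> int k" using hp by (simp add: mult_le_cancel_right_pos)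
  have arg: "mesh_arg r h t = of_int i * h - of_int m * h"
    by (simp add: mesh_arg_def i_def m_def algebra_simps)
  have "mesh_arg r h t = of_int (i - m) * h" by (simp add: arg algebra_simps)
  then show "\<exists>n::int. mesh_arg r h t = of_int n * h \<and> - int k \<le> n" 
    by (intro exI[of _ "i - m"] conjI) (use i0 mk in simp_all)
  have mh0: "of_int m * h \<ge> 0" using m0 hp by simp
  show "mesh_arg r h t \<le> of_int \<lfloor>t / h\<rfloor> * h" using mh0 by (simp add: arg flip: i_def)
  show "mesh_arg r h t \<le> t" using mh0 i1 arg by linarith
  show "t - 2 * q \<le> mesh_arg r h t"
    using arg i1 m1 r_le[OF ih0] hq by linarith
  have "\<bar>r t - r (of_int i * h)\<bar> \<le> modcont r h"
    by (rule abs_diff_le_modcont) (use ih0 t i1 in auto)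
  then show "\<bar>t - r t - mesh_arg r h t\<bar> \<le> 2 * h + modcont r h"
    using arg i1 m1 by linarith
qed

section \<open>Growth and consistency of the approximation\<close>

text \<open>Away from mesh points, \<open>t\<close> is interior to its cell, so the derivative
  within the cell is a full derivative.\<close>

lemma zh_has_derivative_at:
  assumes k: "k \<ge> 1" and h: "h = q / real k" and z: "is_zh a r q k \<phi> z"
    and t: "t > 0" "t \<notin> range (\<lambda>i::int. of_int i * h)"
  shows "(z has_real_derivative (- a t * z (mesh_arg r h t))) (at t)"
proof -
  have hp: "h > 0" using h k q_pos by simp
  define i where "i = nat \<lfloor>t / h\<rfloor>"
  have ii: "\<lfloor>t / h\<rfloor> = int i" using t hp by (simp add: i_def)
  have "real i * h \<le> t" and i2: "t < (real i + 1) * h"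
    using floor_divide_mult_bounds[OF hp, of t] by (simp_all add: ii distrib_right)
  moreover have "t \<noteq> real i * h" using t(2) rangeI[of "\<lambda>i::int. of_int i * h" "int i"] by auto
  ultimately have i1: "real i * h < t" by simp
  have "\<forall>i::nat. \<forall>t\<in>{real i * h..<(real i + 1) * h}.
          (z has_real_derivative (- a t * z (of_int (int i - \<lfloor>r (real i * h) / h\<rfloor>) * h)))
            (at t within {real i * h..<(real i + 1) * h})"
    using z unfolding is_zh_def Let_def h by blast
  then have "(z has_real_derivative (- a t * z (of_int (int i - \<lfloor>r (real i * h) / h\<rfloor>) * h)))
            (at t within {real i * h..<(real i + 1) * h})"
    using i1 i2 by auto
  then have "(z has_real_derivative (- a t * z (of_int (int i - \<lfloor>r (real i * h) / h\<rfloor>) * h)))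
            (at t within {real i * h<..<(real i + 1) * h})"
    by (rule has_field_derivative_subset) auto
  then have "(z has_real_derivative (- a t * z (of_int (int i - \<lfloor>r (real i * h) / h\<rfloor>) * h))) (at t)"
    using i1 i2 at_within_open[of t "{real i * h<..<(real i + 1) * h}"] by auto
  then show ?thesis by (simp add: mesh_arg_def ii)
qed

text \<open>At negative times \<open>is_zh\<close> prescribes \<open>z\<close> only at mesh points,
  so only there can the norm of \<open>\<phi>\<close> bound it.\<close>

lemma zh_initial_bound:
  assumes k: "k \<ge> 1" and h: "h = q / real k" and z: "is_zh a r q k \<phi> z"
    and phi: "continuous_on {-q..0} \<phi>" and n: "- int k \<le> n" "n \<le> 0"
  shows "\<bar>z (of_int n * h)\<bar> \<le> supnorm q \<phi>"
proof -
  have hp: "h > 0" and kh: "real k * h = q" using h k q_pos by auto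
  have "- real k \<le> of_int n" using n(1) by linarith
  then have "- real k * h \<le> of_int n * h" using hp by (intro mult_right_mono) auto
  moreover have "of_int n * h \<le> 0" using n hp by (simp add: mult_le_0_iff)
  ultimately have "\<bar>\<phi> (of_int n * h)\<bar> \<le> supnorm q \<phi>"
    by (intro abs_le_supnorm[OF phi]) (auto simp flip: kh)
  moreover have "z (of_int n * h) = \<phi> (of_int n * h)"
    using z n unfolding is_zh_def Let_def h by blast
  ultimately show ?thesis by simp
qed

text \<open>Induction over cells: within a cell, the slope of \<open>z\<close> involves only values
  up to the left endpoint \<open>c\<close>, so a single bound \<open>M\<close> at \<open>c\<close>
  controls it. One step contributes \<open>1 + a0 * (p - c)\<close>, which is at most the
  corresponding exponential.\<close>

lemma zh_growth:
  assumes k: "k \<ge> 1" and h: "h = q / real k" and z: "is_zh a r q k \<phi> z"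
    and phi: "continuous_on {-q..0} \<phi>" and p: "p \<ge> 0"
  shows "\<bar>z p\<bar> \<le> supnorm q \<phi> * exp (a0 * p)"
proof -
  have hp: "h > 0" using h k q_pos by simp
  have z_cont: "continuous_on {0..} z" using z by (simp add: is_zh_def Let_def)
  have z0: "\<bar>z 0\<bar> \<le> supnorm q \<phi>"
    using zh_initial_bound[OF k h z phi, of 0] by simp
  then have nn: "supnorm q \<phi> \<ge> 0" by linarith
  have grow: "\<bar>z p\<bar> \<le> supnorm q \<phi> * exp (a0 * p)" if "0 \<le> p" "p \<le> real N * h" for N p
    using that
  proof (induction N arbitrary: p)
    case 0
    then show ?case using z0 by simp
  next
    case (Suc N)
    define c where "c = real N * h"
    have c0: "c \<ge> 0" using hp by (simp add: c_def)
    show ?case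
    proof (cases "p \<le> c")
      case True
      then show ?thesis using Suc by (simp add: c_def)
    next
      case False
      define M where "M = supnorm q \<phi> * exp (a0 * c)"
      have M: "supnorm q \<phi> \<le> M" "M \<ge> 0"
        using nn a0_nonneg c0 by (auto simp: M_def mult_le_cancel_left1)
      have "\<bar>z p - z c\<bar> \<le> a0 * M * (p - c)"
      proof (rule abs_diff_le_of_deriv_bound[OF _ finite_mesh_Int_Icc[OF hp]])
        show "continuous_on {c..p} z" by (rule continuous_on_subset[OF z_cont]) (use c0 in auto)
        fix t assume t: "c < t" "t < p" "t \<notin> range (\<lambda>i::int. of_int i * h)"
        show "(z has_real_derivative (- a t * z (mesh_arg r h t))) (at t)"
          by (rule zh_has_derivative_at[OF k h z]) (use t c0 in auto)
        have t0: "t \<ge> 0" using t c0 by simp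
        have "t < (real N + 1) * h" using t Suc.prems by (simp add: algebra_simps)
        then have "t / h < real N + 1" using hp by (simp add: divide_less_eq)
        then have "\<lfloor>t / h\<rfloor> \<le> int N" by linarith
        then have "of_int \<lfloor>t / h\<rfloor> \<le> real N" by linarith
        then have "of_int \<lfloor>t / h\<rfloor> * h \<le> c" unfolding c_def using hp by (intro mult_right_mono) auto
        then have mc: "mesh_arg r h t \<le> c" using mesh_arg_props(2)[OF k h t0] by linarith
        have "\<bar>z (mesh_arg r h t)\<bar> \<le> M"
        proof (cases "mesh_arg r h t \<ge> 0")
          case True
          then have "\<bar>z (mesh_arg r h t)\<bar> \<le> supnorm q \<phi> * exp (a0 * mesh_arg r h t)"
            using Suc.IH mc by (simp add: c_def)
          also have "\<dots> \<le> M" unfolding M_def using nn mc a0_nonneg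
            by (auto intro!: mult_left_mono)
          finally show ?thesis .
        next
          case False
          obtain n where n: "mesh_arg r h t = of_int n * h" "- int k \<le> n"
            using mesh_arg_props(1)[OF k h t0] by blast
          then have "n \<le> 0" using False hp by (auto simp: zero_le_mult_iff)
          then show ?thesis using zh_initial_bound[OF k h z phi n(2)] n M by auto
        qed
        then show "\<bar>- a t * z (mesh_arg r h t)\<bar> \<le> a0 * M"
          using a_bound[OF t0] by (auto simp: abs_mult intro!: mult_mono)
      qed (use False a0_nonneg M in auto)
      moreover have "\<bar>z c\<bar> \<le> M" using Suc.IH[of c] c0 by (simp add: c_def M_def)
      ultimately have "\<bar>z p\<bar> \<le> M * (1 + a0 * (p - c))" by (simp add: algebra_simps)
      also have "\<dots> \<le> M * exp (a0 * (p - c))"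
        using M by (intro mult_left_mono) auto
      also have "\<dots> = supnorm q \<phi> * exp (a0 * p)"
        by (simp add: M_def algebra_simps flip: exp_add)
      finally show ?thesis .
    qed
  qed
  obtain N :: nat where "p / h < real N" using reals_Archimedean2 by blast
  then have "p \<le> real N * h" using hp by (simp add: field_simps)
  then show ?thesis using grow p by blast
qed

text \<open>Both arguments lie in \<open>[t - 2 * q, t]\<close>, where \<open>z\<close> is Lipschitz
  because its slope looks back at most another \<open>2 * q\<close>; hence the window of length
  \<open>4 * q\<close>. From \<open>t \<ge> 3 * q\<close> the segment between them is in the domain
  of continuity of \<open>z\<close>, while the slope may still use initial mesh values, which
  explains the form of hypothesis \<open>B\<close>.\<close>

lemma zh_consistency:
  assumes k: "k \<ge> 1" and h: "h = q / real k" and z: "is_zh a r q k \<phi> z" and t: "t \<ge> 3 * q"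
    and B: "\<And>p. t - 4 * q \<le> p \<Longrightarrow> p \<le> t \<Longrightarrow> p \<ge> 0 \<or> (\<exists>n::int. p = of_int n * h \<and> - int k \<le> n \<and> n \<le> 0) \<Longrightarrow>
      \<bar>z p\<bar> \<le> B"
  shows "\<bar>z (t - r t) - z (mesh_arg r h t)\<bar> \<le> a0 * B * (2 * h + modcont r h)"
proof -
  have hp: "h > 0" using h k q_pos by simp
  have z_cont: "continuous_on {0..} z" using z by (simp add: is_zh_def Let_def)
  have t0: "t \<ge> 0" using t q_pos by linarith
  have B0: "B \<ge> 0" using B[of t] t0 q_pos by auto
  have lip: "\<bar>z d - z c\<bar> \<le> a0 * B * (d - c)" if cd: "t - 2 * q \<le> c" "c \<le> d" "d \<le> t" for c d
  proof (rule abs_diff_le_of_deriv_bound[OF cd(2) finite_mesh_Int_Icc[OF hp]])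
    have c0: "c \<ge> 0" using cd t q_pos by linarith
    show "continuous_on {c..d} z" by (rule continuous_on_subset[OF z_cont]) (use c0 in auto)
    fix u assume u: "c < u" "u < d" "u \<notin> range (\<lambda>i::int. of_int i * h)"
    show "(z has_real_derivative (- a u * z (mesh_arg r h u))) (at u)"
      by (rule zh_has_derivative_at[OF k h z]) (use u c0 in auto)
    have u0: "u \<ge> 0" using u c0 by simp
    note m = mesh_arg_props[OF k h u0]
    obtain n where n: "mesh_arg r h u = of_int n * h" "- int k \<le> n" using m(1) by blast
    have "mesh_arg r h u \<ge> 0 \<or> n \<le> 0" using n hp by (auto simp: zero_le_mult_iff)
    then have "\<bar>z (mesh_arg r h u)\<bar> \<le> B"
      by (intro B) (use m(3,4) u cd n in auto)
    then show "\<bar>- a u * z (mesh_arg r h u)\<bar> \<le> a0 * B"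
      using a_bound[OF u0] by (auto simp: abs_mult intro!: mult_mono)
  qed (use a0_nonneg B0 in auto)
  note m = mesh_arg_props[OF k h t0]
  have r: "t - 2 * q \<le> t - r t" "t - r t \<le> t" using r_nonneg[OF t0] r_le[OF t0] q_pos by auto
  have "\<bar>z (t - r t) - z (mesh_arg r h t)\<bar> \<le> a0 * B * \<bar>t - r t - mesh_arg r h t\<bar>"
  proof (cases "mesh_arg r h t \<le> t - r t")
    case True
    then show ?thesis using lip[of "mesh_arg r h t" "t - r t"] m r by auto
  next
    case False
    then show ?thesis using lip[of "t - r t" "mesh_arg r h t"] m r by (auto simp: abs_minus_commute)
  qed
  also have "\<dots> \<le> a0 * B * (2 * h + modcont r h)"
    using m(5) a0_nonneg B0 by (intro mult_left_mono) auto
  finally show ?thesis .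
qed

end

subsection \<open>The error bound\<close>

text \<open>Up to the first violation, the claimed bound itself controls the \<open>E\<close> part
  of the perturbation; \<open>perturbation_bound\<close> then returns a strictly smaller bound, a
  contradiction.\<close>

lemma (in exp_stable_dde) zh_error_bound:
  fixes \<phi> x z :: "real \<Rightarrow> real"
  assumes k: "k \<ge> 1" and h: "h = q / real k"
    and K1: "K1 = a0\<^sup>2 * (2 * h + modcont r h) * K"
    and eta: "\<eta> > 0" "\<eta> + K1 * exp (4 * q * \<eta>) \<le> \<sigma>"
    and t0: "t0 \<ge> 3 * q" and phi: "continuous_on {-q..0} \<phi>"
    and x: "is_U a r q 0 \<phi> x" and z: "is_zh a r q k \<phi> z"
    and A: "\<And>u. u \<in> {t0 - q..t0} \<Longrightarrow> K * \<bar>x u - z u\<bar> \<le> A" and t: "t \<ge> t0"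
  shows "\<bar>x t - z t\<bar> \<le>
    (A + K1 * ((K + exp (a0 * t0)) * exp (4 * q * \<sigma>)) * supnorm q \<phi> * t) * exp (- \<eta> * (t - t0))"
proof -
  \<comment> \<open>The sum covers both \<open>x\<close> after \<open>t0\<close>, through
    \<open>K\<close>, and \<open>z\<close> before \<open>t0\<close>, through its growth;
    \<open>exp (4 * q * \<sigma>)\<close> pays for looking back by \<open>4 * q\<close>.\<close>
  define M where "M = (K + exp (a0 * t0)) * exp (4 * q * \<sigma>)"
  define b where "b = M * supnorm q \<phi>"
  define N where "N = K1 * b"
  define \<kappa> where "\<kappa> = a0\<^sup>2 * (2 * h + modcont r h)"
  have K1k: "K1 = K * \<kappa>" by (simp add: K1 \<kappa>_def)
  have hp: "h > 0" using h k q_pos by simp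
  have kap: "\<kappa> \<ge> 0" unfolding \<kappa>_def using hp modcont_nonneg[of h] by simp
  have K10: "K1 \<ge> 0" using K1k kap K_pos by simp
  have t0p: "t0 > 0" using t0 q_pos by linarith
  have z_cont: "continuous_on {0..} z" using z by (simp add: is_zh_def Let_def)
  have x_sol: "dde_sol a r q 0 x" using x by (simp add: is_U_def)
  have x_cont: "continuous_on {-q..} x" using x_sol by (simp add: dde_sol_def)
  have nn: "supnorm q \<phi> \<ge> 0" using abs_le_supnorm[OF phi, of 0] q_pos by auto
  have M0: "M \<ge> 0" unfolding M_def using K_pos by (simp add: add_nonneg_nonneg)
  have b0: "b \<ge> 0" using M0 nn by (simp add: b_def)
  have N0: "N \<ge> 0" using K10 b0 by (simp add: N_def)
  have A0: "A \<ge> 0"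
  proof -
    have "0 \<le> K * \<bar>x t0 - z t0\<bar>" using K_pos by simp
    also have "\<dots> \<le> A" by (rule A) (use q_pos in auto)
    finally show ?thesis .
  qed
  have eta_le: "\<eta> \<le> \<sigma>"
    using eta(2) mult_nonneg_nonneg[OF K10, of "exp (4 * q * \<eta>)"] by simp
  define E where "E t = x t - z t" for t
  define f where "f t = - a t * (z (t - r t) - z (mesh_arg r h t))" for t
  define S where "S = range (\<lambda>i::int. of_int i * h)"
  have E_cont: "continuous_on {t0 - q..} E"
    unfolding E_def
    by (intro continuous_intros continuous_on_subset[OF x_cont] continuous_on_subset[OF z_cont])
      (use t0 q_pos in auto)
  have E_der: "(E has_real_derivative (- a t * E (t - r t) + f t)) (at t)" if "t0 < t" "t \<notin> S" for t
  proof -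
    have "(x has_real_derivative (- a t * x (t - r t))) (at t)"
      by (rule dde_sol_has_derivative_at[OF x_sol]) (use that t0p in auto)
    moreover have "(z has_real_derivative (- a t * z (mesh_arg r h t))) (at t)"
      by (rule zh_has_derivative_at[OF k h z]) (use that t0p in \<open>auto simp: S_def\<close>)
    ultimately show ?thesis
      unfolding E_def f_def by (auto intro!: derivative_eq_intros simp: algebra_simps)
  qed
  have strict: "\<bar>E t\<bar> \<le> (A + e + N * t) * exp (- \<eta> * (t - t0))" if e: "e > 0" and t: "t \<ge> t0" for e t
  proof (rule ccontr)
    \<comment> \<open>\<open>T\<close> is the first time at which \<open>\<bar>E\<bar>\<close> reaches \<open>u\<close>; the supersolution \<open>v < u\<close> rules it out.\<close>
    define u where "u t = (A + e + N * t) * exp (- \<eta> * (t - t0))" for t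
    assume "\<not> \<bar>E t\<bar> \<le> (A + e + N * t) * exp (- \<eta> * (t - t0))"
    then have viol: "u t \<le> \<bar>E t\<bar>" by (simp add: u_def)
    have u_nonneg: "u s \<ge> 0" if "s \<ge> t0" for s
      using that A0 e N0 t0p by (simp add: u_def)
    define F where "F = {s \<in> {t0..t}. u s - \<bar>E s\<bar> \<le> 0}"
    have "continuous_on {t0..t} (\<lambda>s. u s - \<bar>E s\<bar>)"
      unfolding u_def by (intro continuous_intros continuous_on_subset[OF E_cont]) (use q_pos in auto)
    then have "closed ({t0..t} \<inter> (\<lambda>s. u s - \<bar>E s\<bar>) -` {..0})"
      by (rule continuous_closed_preimage) auto
    also have "{t0..t} \<inter> (\<lambda>s. u s - \<bar>E s\<bar>) -` {..0} = F" by (auto simp: F_def)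
    finally have "closed F" .
    moreover have "bounded F" by (rule bounded_subset[of "{t0..t}"]) (auto simp: F_def)
    ultimately have "compact F" by (simp add: compact_eq_bounded_closed)
    moreover have "t \<in> F" using viol t by (simp add: F_def)
    ultimately obtain T where T: "T \<in> F" "\<And>s. s \<in> F \<Longrightarrow> T \<le> s"
      using compact_attains_inf[of F] by blast
    have T1: "t0 \<le> T" "T \<le> t" "u T \<le> \<bar>E T\<bar>" using T(1) by (auto simp: F_def)
    have below: "\<bar>E s\<bar> \<le> u s" if "t0 \<le> s" "s < T" for s
      using T(2)[of s] that T1 by (force simp: F_def)
    \<comment> \<open>The first term bounds the contribution of \<open>E\<close>; the second bounds
      that of \<open>x\<close> after \<open>t0\<close> and of \<open>z\<close> before
      \<open>t0\<close>.\<close>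
    define g where "g s = \<kappa> * (exp (4 * q * \<eta>) * u s + b * exp (- \<sigma> * (s - t0)))" for s
    \<comment> \<open>Subtracting a solution of \<open>y' = - \<sigma> * y\<close> of size
      \<open>e\<close> preserves the supersolution inequality and leaves
      \<open>v t0 = A + N * t0 \<ge> A\<close>, yet makes \<open>v\<close> strictly smaller than
      \<open>u\<close>.\<close>
    define v where "v s = u s - e * exp (- \<sigma> * (s - t0))" for s
    \<comment> \<open>The factor \<open>N * t\<close> in \<open>u\<close> contributes the term
      \<open>N * exp (- \<eta> * (s - t0))\<close>, which absorbs the decaying forcing from
      \<open>b\<close>; this is the origin of the linear factor \<open>t\<close>.\<close>
    define v' where "v' s = - \<eta> * u s + N * exp (- \<eta> * (s - t0)) + \<sigma> * (e * exp (- \<sigma> * (s - t0)))" for s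
    have "\<bar>E T\<bar> \<le> v T"
    proof (rule perturbation_bound[where ?t0.0 = t0 and T = T and E = E and v = v and g = g and f = f and v' = v' and S = S])
      show "t0 \<ge> 0" using t0p by simp
      show "finite (S \<inter> {c..d})" for c d unfolding S_def by (rule finite_mesh_Int_Icc[OF hp])
      show "continuous_on {t0..T} g" unfolding g_def u_def by (intro continuous_intros)
      show "g s \<ge> 0" if "s \<in> {t0..T}" for s
        unfolding g_def using kap b0 u_nonneg[of s] that by auto
      show "(v has_real_derivative v' s) (at s within {t0..T})" for s
        unfolding v_def v'_def u_def by (auto intro!: derivative_eq_intros simp: algebra_simps)
      show "- \<sigma> * v s + K * g s \<le> v' s" if "s \<in> {t0..T}" for s
      proof -
        have "exp (- \<sigma> * (s - t0)) \<le> exp (- \<eta> * (s - t0))"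
          using eta_le that by (simp add: mult_right_mono)
        then have 1: "N * exp (- \<sigma> * (s - t0)) \<le> N * exp (- \<eta> * (s - t0))"
          using N0 by (rule mult_left_mono)
        have 2: "(\<eta> + K1 * exp (4 * q * \<eta>)) * u s \<le> \<sigma> * u s"
          using eta(2) u_nonneg[of s] that by (intro mult_right_mono) auto
        have "K * g s = K1 * exp (4 * q * \<eta>) * u s + N * exp (- \<sigma> * (s - t0))"
          by (simp add: g_def K1k N_def algebra_simps)
        then show ?thesis using 1 2 by (simp add: v_def v'_def algebra_simps)
      qed
      show "K * \<bar>E s\<bar> \<le> v t0" if "s \<in> {t0 - q..t0}" for s
      proof -
        have "K * \<bar>E s\<bar> \<le> A" using A[OF that] by (simp add: E_def)
        moreover have "N * t0 \<ge> 0" using N0 t0p by simp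
        ultimately show ?thesis by (simp add: v_def u_def)
      qed
      fix s assume s: "t0 < s" "s < T" "s \<notin> S"
      define \<beta> where "\<beta> = exp (4 * q * \<eta>) * u s + b * exp (- \<sigma> * (s - t0))"
      have us: "exp (4 * q * \<eta>) * u s \<ge> 0" using u_nonneg[of s] s by simp
      have beta0: "\<beta> \<ge> 0" unfolding \<beta>_def using us b0 by simp
      have "\<bar>z (s - r s) - z (mesh_arg r h s)\<bar> \<le> a0 * \<beta> * (2 * h + modcont r h)"
      proof (rule zh_consistency[OF k h z])
        show "3 * q \<le> s" using s t0 by simp
        fix p assume p: "s - 4 * q \<le> p" "p \<le> s"
          and dom: "p \<ge> 0 \<or> (\<exists>n::int. p = of_int n * h \<and> - int k \<le> n \<and> n \<le> 0)"
        show "\<bar>z p\<bar> \<le> \<beta>"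
        proof (cases "p \<ge> t0")
          case True
          \<comment> \<open>The linear prefactor increases with time, so only the exponential is
            lost, over a distance of at most \<open>4 * q\<close>.\<close>
          have "u p \<le> exp (4 * q * \<eta>) * u s"
          proof -
            have "exp (- \<eta> * (p - t0)) \<le> exp (4 * q * \<eta> + - \<eta> * (s - t0))"
              using mult_left_mono[OF p(1), of \<eta>] eta by (simp add: algebra_simps)
            moreover have "A + e + N * p \<le> A + e + N * s" using p N0 by (simp add: mult_left_mono)
            moreover have "A + e + N * s \<ge> 0" using A0 e N0 s t0p by simp
            ultimately have "u p \<le> (A + e + N * s) * exp (4 * q * \<eta> + - \<eta> * (s - t0))"
              unfolding u_def by (intro mult_mono) auto
            then show ?thesis unfolding u_def exp_add by (simp only: mult_ac)
          qed
          moreover have "\<bar>E p\<bar> \<le> u p" using below[of p] True p s by auto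
          moreover have "\<bar>x p\<bar> \<le> b * exp (- \<sigma> * (s - t0))"
          proof -
            have "\<bar>x p\<bar> \<le> K * supnorm q \<phi> * exp (- \<sigma> * (p - 0))"
              by (rule exp_stable[OF _ phi x]) (use True t0p in auto)
            also have "\<dots> \<le> ((K + exp (a0 * t0)) * supnorm q \<phi>) * exp (4 * q * \<sigma> + - \<sigma> * (s - t0))"
            proof (intro mult_mono)
              have "\<sigma> * (s - 4 * q) \<le> \<sigma> * p" "0 \<le> \<sigma> * t0"
                using sigma_pos p t0p by (auto intro: mult_left_mono)
              then show "exp (- \<sigma> * (p - 0)) \<le> exp (4 * q * \<sigma> + - \<sigma> * (s - t0))"
                by (simp add: algebra_simps)
            qed (use nn K_pos in \<open>auto intro: add_nonneg_nonneg\<close>)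
            also have "\<dots> = b * exp (- \<sigma> * (s - t0))"
              unfolding b_def M_def exp_add by (simp only: mult_ac)
            finally show ?thesis .
          qed
          ultimately show ?thesis unfolding \<beta>_def E_def by linarith
        next
          case False
          have "\<bar>z p\<bar> \<le> supnorm q \<phi> * exp (a0 * t0)"
          proof (cases "p \<ge> 0")
            case True
            have "\<bar>z p\<bar> \<le> supnorm q \<phi> * exp (a0 * p)" by (rule zh_growth[OF k h z phi True])
            also have "\<dots> \<le> supnorm q \<phi> * exp (a0 * t0)"
              using nn False a0_nonneg by (auto intro!: mult_left_mono)
            finally show ?thesis .
          next
            case False
            then have "\<bar>z p\<bar> \<le> supnorm q \<phi> * 1"
              using dom zh_initial_bound[OF k h z phi] by auto
            also have "\<dots> \<le> supnorm q \<phi> * exp (a0 * t0)"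
              using nn a0_nonneg t0p by (intro mult_left_mono) auto
            finally show ?thesis .
          qed
          also have "\<dots> = (exp (a0 * t0) * supnorm q \<phi>) * 1" by simp
          also have "\<dots> \<le> ((K + exp (a0 * t0)) * supnorm q \<phi>) * exp (4 * q * \<sigma> + - \<sigma> * (s - t0))"
          proof (intro mult_mono)
            \<comment> \<open>As \<open>p\<close> precedes \<open>t0\<close> and is within
              \<open>4 * q\<close> of \<open>s\<close>, the time \<open>s\<close> is still within
              \<open>4 * q\<close> of \<open>t0\<close>.\<close>
            have "\<sigma> * (s - t0) \<le> \<sigma> * (4 * q)"
              using sigma_pos p False by (intro mult_left_mono) auto
            then show "1 \<le> exp (4 * q * \<sigma> + - \<sigma> * (s - t0))" by (simp add: algebra_simps)
          qed (use nn K_pos in \<open>auto intro: add_nonneg_nonneg\<close>)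
          also have "\<dots> = b * exp (- \<sigma> * (s - t0))"
            unfolding b_def M_def exp_add by (simp only: mult_ac)
          finally show ?thesis using us unfolding \<beta>_def by linarith
        qed
      qed
      then have "\<bar>f s\<bar> \<le> a0 * (a0 * \<beta> * (2 * h + modcont r h))"
        unfolding f_def abs_mult using a_bound[of s] s t0p a0_nonneg
        by (intro mult_mono) auto
      also have "\<dots> = g s" by (simp add: g_def \<kappa>_def \<beta>_def power2_eq_square)
      finally show "\<bar>f s\<bar> \<le> g s" .
    qed (use T1 E_cont E_der in auto)
    also have "v T < u T" using e by (simp add: v_def)
    finally show False using T1 by simp
  qed
  have "\<bar>E t\<bar> \<le> (A + N * t) * exp (- \<eta> * (t - t0))"
  proof (rule field_le_epsilon)
    fix e :: real assume e: "e > 0"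
    have "e * exp (- \<eta> * (t - t0)) \<le> e * 1"
      using e eta t by (intro mult_left_mono) auto
    then show "\<bar>E t\<bar> \<le> (A + N * t) * exp (- \<eta> * (t - t0)) + e"
      using strict[OF e t] by (simp add: algebra_simps)
  qed
  then show ?thesis by (simp add: E_def N_def b_def M_def algebra_simps)
qed

section \<open>Choice of the constants and conclusion\<close>

theorem theorem4p1:
  fixes a r :: "real \<Rightarrow> real" and q K \<sigma> :: real
  assumes q_pos: "q > 0"
    and a_cont: "continuous_on {0..} a"
    and a_nonneg: "\<forall>t\<ge>0. a t \<ge> 0"
    and r_range: "\<forall>t\<ge>0. 0 \<le> r t \<and> r t \<le> q"
    and q_sup: "q = (SUP t\<in>{0..}. r t)"
    and A1: "unif_asym_stable a r q"
    and A2: "bdd_above ((\<lambda>t. \<bar>a t\<bar>) ` {0..})"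
    and A3: "uniformly_continuous_on {0..} r"
    and K_pos: "K > 0" and sigma_pos: "\<sigma> > 0"
    and expbound: "\<forall>s\<ge>0. \<forall>\<phi> x. continuous_on {-q..0} \<phi> \<and> is_U a r q s \<phi> x \<longrightarrow>
                      (\<forall>t\<ge>s. \<bar>x t\<bar> \<le> K * supnorm q \<phi> * exp (- \<sigma> * (t - s)))"
  shows "let a0 = (SUP t\<in>{0..}. \<bar>a t\<bar>);
             t0 = 3 * q + modcont r q;
             K1 = (\<lambda>h. a0\<^sup>2 * (2 * h + modcont r h) * K)
         in ((\<lambda>k::nat. K1 (q / real k)) \<longlonglongrightarrow> 0) \<and>
            (\<exists>M1>0. \<forall>k::nat. k \<ge> 1 \<longrightarrow> K1 (q / real k) < \<sigma> \<longrightarrow>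
               (\<exists>\<eta>>0. \<forall>\<phi> x z. continuous_on {-q..0} \<phi> \<and> is_U a r q 0 \<phi> x \<and> is_zh a r q k \<phi> z \<longrightarrow>
                  (\<forall>t\<ge>t0. \<bar>x t - z t\<bar> \<le>
                     (K * (SUP s\<in>{t0 - q..t0}. \<bar>x s - z s\<bar>)
                      + K1 (q / real k) * M1 * supnorm q \<phi> * t) * exp (- \<eta> * (t - t0)))))"
proof -
  define a0 where "a0 = (SUP t\<in>{0..}. \<bar>a t\<bar>)"
  define t0 where "t0 = 3 * q + modcont r q"
  define K1 where "K1 h = a0\<^sup>2 * (2 * h + modcont r h) * K" for h
  \<comment> \<open>This is the constant \<open>M\<close> from the error bound; \<open>t0\<close>
    involves \<open>q\<close> and \<open>modcont r q\<close> only, so \<open>M1\<close> depends on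
    neither the mesh nor \<open>\<phi>\<close>.\<close>
  define M1 where "M1 = (K + exp (a0 * t0)) * exp (4 * q * \<sigma>)"
  interpret exp_stable_dde a r q a0 K \<sigma>
  proof
    show "\<bar>a t\<bar> \<le> a0" if "t \<ge> 0" for t
      unfolding a0_def by (rule cSUP_upper2[OF A2, of t]) (use that in auto)
    show "continuous_on {0..} r" by (rule uniformly_continuous_imp_continuous[OF A3])
    show "\<bar>x t\<bar> \<le> K * supnorm q \<phi> * exp (- \<sigma> * (t - s))"
      if "s \<ge> 0" "continuous_on {-q..0} \<phi>" "is_U a r q s \<phi> x" "t \<ge> s" for s \<phi> x t
      using expbound that by blast
  qed (use q_pos a_cont r_range K_pos sigma_pos in auto)
  have t0: "t0 \<ge> 3 * q" using modcont_nonneg[of q] q_pos by (simp add: t0_def)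
  have "(\<lambda>k. K1 (q / real k)) \<longlonglongrightarrow> a0\<^sup>2 * (2 * 0 + 0) * K"
    unfolding K1_def by (intro tendsto_intros lim_const_over_n tendsto_modcont[OF A3])
  then have lim: "(\<lambda>k. K1 (q / real k)) \<longlonglongrightarrow> 0" by simp
  have M1: "M1 > 0" using K_pos by (simp add: M1_def add_pos_pos)
  have main: "\<exists>\<eta>>0. \<forall>\<phi> x z. continuous_on {-q..0} \<phi> \<and> is_U a r q 0 \<phi> x \<and> is_zh a r q k \<phi> z \<longrightarrow>
      (\<forall>t\<ge>t0. \<bar>x t - z t\<bar> \<le> (K * (SUP s\<in>{t0 - q..t0}. \<bar>x s - z s\<bar>)
        + K1 (q / real k) * M1 * supnorm q \<phi> * t) * exp (- \<eta> * (t - t0)))"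
    if k: "k \<ge> 1" and small: "K1 (q / real k) < \<sigma>" for k :: nat
  proof -
    define \<kappa> where "\<kappa> = K1 (q / real k)"
    \<comment> \<open>As \<open>\<eta>\<close> decreases to 0 the expression tends to
      \<open>\<kappa> < \<sigma>\<close>, so some positive \<open>\<eta>\<close> satisfies the
      requirement; it is fixed before \<open>\<phi>\<close>, \<open>x\<close> and
      \<open>z\<close>.\<close>
    have "((\<lambda>\<eta>. \<eta> + \<kappa> * exp (4 * q * \<eta>)) \<longlongrightarrow> 0 + \<kappa> * exp (4 * q * 0)) (at_right 0)"
      by (intro tendsto_intros)
    then have "\<forall>\<^sub>F \<eta> in at_right 0. \<eta> + \<kappa> * exp (4 * q * \<eta>) < \<sigma>"
      by (rule order_tendstoD) (use small in \<open>simp add: \<kappa>_def\<close>)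
    then have "\<forall>\<^sub>F \<eta> in at_right 0. \<eta> + \<kappa> * exp (4 * q * \<eta>) < \<sigma> \<and> \<eta> > 0"
      using eventually_at_right_less[of "0::real"] by eventually_elim auto
    then obtain \<eta> where eta: "\<eta> + \<kappa> * exp (4 * q * \<eta>) < \<sigma>" "\<eta> > 0"
      using eventually_happens'[OF trivial_limit_at_right_real] by blast
    have "\<bar>x t - z t\<bar> \<le> (K * (SUP s\<in>{t0 - q..t0}. \<bar>x s - z s\<bar>)
        + \<kappa> * M1 * supnorm q \<phi> * t) * exp (- \<eta> * (t - t0))"
      if phi: "continuous_on {-q..0} \<phi>" and x: "is_U a r q 0 \<phi> x" and z: "is_zh a r q k \<phi> z"
        and t: "t \<ge> t0" for \<phi> x z t
      unfolding M1_def
    proof (rule zh_error_bound[OF k refl _ eta(2) _ t0 phi x z _ t])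
      show "\<kappa> = a0\<^sup>2 * (2 * (q / real k) + modcont r (q / real k)) * K"
        by (simp add: \<kappa>_def K1_def)
      show "\<eta> + \<kappa> * exp (4 * q * \<eta>) \<le> \<sigma>" using eta by simp
      fix u assume u: "u \<in> {t0 - q..t0}"
      \<comment> \<open>The real supremum is an upper bound only for a bounded set; since
        \<open>t0 - q \<ge> 0\<close>, continuity on the compact window gives boundedness.\<close>
      have "continuous_on {-q..} x" "continuous_on {0..} z"
        using x z by (auto simp: is_U_def dde_sol_def is_zh_def Let_def)
      then have "continuous_on {t0 - q..t0} (\<lambda>s. \<bar>x s - z s\<bar>)"
        using t0 q_pos by (intro continuous_intros) (auto elim: continuous_on_subset)
      then have "compact ((\<lambda>s. \<bar>x s - z s\<bar>) ` {t0 - q..t0})"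
        by (rule compact_continuous_image) auto
      then have "bdd_above ((\<lambda>s. \<bar>x s - z s\<bar>) ` {t0 - q..t0})"
        by (intro bounded_imp_bdd_above compact_imp_bounded)
      then have "\<bar>x u - z u\<bar> \<le> (SUP s\<in>{t0 - q..t0}. \<bar>x s - z s\<bar>)"
        by (rule cSUP_upper2[OF _ u]) simp
      then show "K * \<bar>x u - z u\<bar> \<le> K * (SUP s\<in>{t0 - q..t0}. \<bar>x s - z s\<bar>)"
        using K_pos by (intro mult_left_mono) auto
    qed
    then show ?thesis using eta(2) unfolding \<kappa>_def by blast
  qed
  show ?thesis
    unfolding Let_def a0_def[symmetric] t0_def[symmetric] K1_def[symmetric]
    using lim M1 main by blast
qed

end
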